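(* Let $m\geq 1$ be an integer and let $f: S^m\rightarrow \mathbb{R}$ be a continuous map such that $f(-p)=-f(p)$ for all $p\in S^m$. If $m+1$ is a power of $2$, then there are $m+1$ points $p_1, \ldots, p_{m+1}$ in $S^m$ such that $f(p_1)=\cdots=f(p_{m+1})$, where $p_1, \ldots, p_{m+1}$ are linearly dependent and any $m$ points of $p_1, \ldots, p_{m+1}$ are linearly independent.
   Context: $S^m$ denotes the unit sphere in $\mathbb{R}^{m+1}$; linear (in)dependence refers to the points regarded as vectors of $\mathbb{R}^{m+1}$. "Any $m$ points of $p_1,\ldots,p_{m+1}$" means the family $(p_i)_{i\in I}$ for any subset $I\subset\{1,\ldots,m+1\}$ with $m$ elements; likewise, linear dependence of $p_1,\ldots,p_{m+1}$ is that of the indexed family. *)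

theory Defs
  imports "HOL-Analysis.Analysis"
begin

(* The library predicate independent is about sets, so it ignores repetitions;
   the family (v, v) is dependent although {v} may be independent. *)
definition indep_family :: "'i set \<Rightarrow> ('i \<Rightarrow> 'v::real_vector) \<Rightarrow> bool" where
  "indep_family I p \<longleftrightarrow> inj_on p I \<and> independent (p ` I)"

lemma indep_family_iff_coeffs:
  fixes p :: "'i \<Rightarrow> 'v::real_vector"
  assumes "finite I"
  shows "indep_family I p \<longleftrightarrow>
    (\<forall>c. (\<Sum>i\<in>I. c i *\<^sub>R p i) = 0 \<longrightarrow> (\<forall>i\<in>I. c i = 0))"
proof
  assume "indep_family I p"
  then have inj: "inj_on p I" and ind: "independent (p ` I)"
    by (auto simp: indep_family_def)
  show "\<forall>c. (\<Sum>i\<in>I. c i *\<^sub>R p i) = 0 \<longrightarrow> (\<forall>i\<in>I. c i = 0)"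
  proof (intro allI impI ballI)
    fix c i
    assume 0: "(\<Sum>i\<in>I. c i *\<^sub>R p i) = 0" and i: "i \<in> I"
    let ?u = "\<lambda>v. c (inv_into I p v)"
    have "(\<Sum>v\<in>p ` I. ?u v *\<^sub>R v) = (\<Sum>i\<in>I. c i *\<^sub>R p i)"
      using inj by (simp add: sum.reindex)
    then have "?u (p i) = 0"
      using independentD[OF ind _ order_refl, of ?u "p i"] assms i 0 by simp
    then show "c i = 0" using inj i by simp
  qed
next
  assume C: "\<forall>c. (\<Sum>i\<in>I. c i *\<^sub>R p i) = 0 \<longrightarrow> (\<forall>i\<in>I. c i = 0)"
  have inj: "inj_on p I"
  proof (rule inj_onI, rule ccontr)
    fix i j
    assume ij: "i \<in> I" "j \<in> I" "p i = p j" "i \<noteq> j"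
    let ?c = "\<lambda>k. if k = i then 1 else if k = j then -1 else (0::real)"
    have "(\<Sum>k\<in>I. ?c k *\<^sub>R p k) = (\<Sum>k\<in>{i,j}. ?c k *\<^sub>R p k)"
      using assms ij by (intro sum.mono_neutral_right) auto
    also have "\<dots> = 0" using ij by simp
    finally have "?c i = 0" using C[rule_format, of ?c i] ij(1) by blast
    then show False by simp
  qed
  have "independent (p ` I)"
  proof (rule independent_if_scalars_zero)
    fix u v
    assume "(\<Sum>x\<in>p ` I. u x *\<^sub>R x) = 0" and v: "v \<in> p ` I"
    then have "(\<Sum>i\<in>I. u (p i) *\<^sub>R p i) = 0"
      using inj by (simp add: sum.reindex)
    then show "u v = 0" using C v by fastforce
  qed (use assms in auto)
  with inj show "indep_family I p" by (simp add: indep_family_def)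
qed

end

theory Submission
  imports Defs
begin

text \<open>
  A level set of \<open>f\<close> on the unit sphere of a hyperplane \<open>H\<close> through the origin is rich enough to
  contain the required points when \<open>m \<ge> 3\<close>.  Write \<open>m = k + 2\<close> with \<open>k \<ge> 1\<close>, so that the ambient
  space has dimension \<open>k + 3\<close> and \<open>H\<close> has dimension \<open>k + 2\<close>.  The points sought form a circuit of
  \<open>k + 3\<close> vectors: a dependent set all of whose proper subsets are independent.

  If \<open>f\<close> is not identically zero, choose \<open>H\<close> through a point \<open>p\<close> with \<open>f p > 0\<close>, a value
  \<open>0 < c < f p\<close>, and let \<open>L\<close> be the set of unit vectors of \<open>H\<close> on which \<open>f\<close> equals \<open>c\<close>.
  Every hyperplane \<open>W\<close> of \<open>H\<close> contains, by oddness, a unit vector \<open>w\<close> with \<open>f w \<le> 0 < c\<close>.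
  A segment from a point near \<open>p\<close> to \<open>w\<close> must cross the level \<open>c\<close> before it reaches \<open>w\<close>, and
  for a generic starting point it meets \<open>W\<close> and any prescribed finite family of subspaces of
  codimension two in \<open>H\<close> at most in \<open>w\<close>.  Hence \<open>L - W\<close> is never covered by finitely many
  subspaces of codimension two (\<open>level_set_not_thin\<close>).

  The rest is combinatorial and uses only this property of \<open>L\<close>
  (\<open>independent_with_fat_complement\<close>, \<open>spanning_circuit_exists\<close>): take \<open>k + 1\<close> independent points
  of \<open>L\<close> spanning a suitably chosen hyperplane of \<open>H\<close>, and add two points of \<open>L\<close> outside it,
  the second one in general position with respect to the others.  If \<open>f\<close> vanishes on the whole
  sphere, the argument is applied to a linear form instead.  Of the remaining cases, \<open>m = 1\<close> is trivial, since a repeated point is a dependent pair, and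
  \<open>m = 2\<close> does not occur because 3 is not a power of 2.
\<close>

section \<open>Sets covered by finitely many subspaces of small dimension\<close>

text \<open>
  In the applications \<open>k\<close> is two less than the dimension of the
  subspace in which everything takes place, so that thin means negligible even inside a hyperplane.
\<close>
definition thin :: "nat \<Rightarrow> 'a::euclidean_space set \<Rightarrow> bool" where
  "thin k X \<longleftrightarrow> (\<exists>\<N>. finite \<N> \<and> (\<forall>N\<in>\<N>. subspace N \<and> dim N \<le> k) \<and> X \<subseteq> \<Union>\<N>)"

lemma thin_subset: "thin k Y \<Longrightarrow> X \<subseteq> Y \<Longrightarrow> thin k X"
  unfolding thin_def by (meson order_trans)

lemma thin_subspace: "subspace N \<Longrightarrow> dim N \<le> k \<Longrightarrow> thin k N"
  unfolding thin_def by (intro exI[of _ "{N}"]) auto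

lemma thin_UN:
  assumes "finite I" and "\<And>i. i \<in> I \<Longrightarrow> thin k (X i)"
  shows "thin k (\<Union>i\<in>I. X i)"
proof -
  have "\<forall>i\<in>I. \<exists>\<N>. finite \<N> \<and> (\<forall>N\<in>\<N>. subspace N \<and> dim N \<le> k) \<and> X i \<subseteq> \<Union>\<N>"
    using assms(2) by (auto simp: thin_def)
  then obtain \<N> where "\<forall>i\<in>I. finite (\<N> i) \<and> (\<forall>N\<in>\<N> i. subspace N \<and> dim N \<le> k) \<and> X i \<subseteq> \<Union>(\<N> i)"
    by metis
  then show ?thesis
    unfolding thin_def using assms(1)
    by (intro exI[of _ "\<Union>i\<in>I. \<N> i"]) (auto, blast)
qed

lemma thin_Un: "thin k X \<Longrightarrow> thin k Y \<Longrightarrow> thin k (X \<union> Y)"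
  using thin_UN[of "{X, Y}" k "\<lambda>Z. Z"] by auto

lemma thin_Int_hyperplanes:
  assumes "subspace V" "subspace W" "dim V = Suc k" "dim W = Suc k" "V \<noteq> W"
  shows "thin k (V \<inter> W)"
proof (rule thin_subspace)
  show "subspace (V \<inter> W)" using assms subspace_inter by blast
  have "dim (V \<inter> W) \<noteq> Suc k"
  proof
    assume D: "dim (V \<inter> W) = Suc k"
    have "V \<inter> W = V" "V \<inter> W = W"
      using subspace_dim_equal[of "V \<inter> W" V] subspace_dim_equal[of "V \<inter> W" W]
        assms D subspace_inter[of V W] by auto
    then show False using assms(5) by simp
  qed
  moreover have "dim (V \<inter> W) \<le> dim V" by (rule dim_subset) auto
  ultimately show "dim (V \<inter> W) \<le> k" using assms(3) by linarith
qed

lemma span_eq_if_card_eq_dim: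
  fixes Q :: "'a::euclidean_space set"
  assumes "subspace W" "Q \<subseteq> W" "independent Q" "card Q = dim W"
  shows "span Q = W"
proof (rule subspace_dim_equal)
  show "span Q \<subseteq> W" using assms(1,2) by (intro span_minimal)
  show "dim (span Q) \<ge> dim W" using assms(3,4) by (simp add: dim_eq_card_independent)
qed (use assms(1) in auto)

lemma not_thin_independent:
  assumes "\<not> thin k X"
  obtains Q where "Q \<subseteq> X" "independent Q" "card Q = Suc k"
proof -
  obtain B where B: "B \<subseteq> X" "independent B" "X \<subseteq> span B" "card B = dim X"
    using basis_exists by blast
  have "\<not> dim (span B) \<le> k"
    using assms thin_subset[OF thin_subspace[of "span B" k] B(3)] by auto
  then have "Suc k \<le> card B" using B by (simp add: dim_eq_card_independent)
  then obtain Q where "Q \<subseteq> B" "card Q = Suc k"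
    using obtain_subset_with_card_n by metis
  then show ?thesis using that B independent_mono by blast
qed

text \<open>
  A finite union of proper subspaces is closed with empty interior.  Starting from a point that
  avoids the subspaces treated so far, a small push in a direction outside the next one leaves it
  without returning to the earlier ones.
\<close>
lemma generic_point:
  fixes H :: "'a::euclidean_space set"
  assumes H: "subspace H" and fin: "finite \<N>"
    and N: "\<And>N. N \<in> \<N> \<Longrightarrow> subspace N \<and> \<not> H \<subseteq> N"
    and x: "x \<in> H" and e: "0 < e"
  shows "\<exists>y\<in>H. dist y x < e \<and> y \<notin> \<Union>\<N>"
  using fin N
proof (induction \<N>)
  case empty
  then show ?case using x e by (auto intro!: bexI[of _ x])
next
  case (insert N \<N>)
  obtain y where y: "y \<in> H" "dist y x < e" "y \<notin> \<Union>\<N>"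
    using insert.IH insert.prems by auto
  have sN: "subspace N" and "\<not> H \<subseteq> N" using insert.prems by auto
  then obtain v where v: "v \<in> H" "v \<notin> N" by blast
  show ?case
  proof (cases "y \<in> N")
    case False
    then show ?thesis using y by auto
  next
    case True
    have "open (- \<Union>\<N>)"
      using insert.hyps(1) insert.prems closed_subspace by (intro open_Compl closed_Union) auto
    then have "open (- \<Union>\<N> \<inter> ball x e)" by blast
    moreover have "y \<in> - \<Union>\<N> \<inter> ball x e" using y by (auto simp: dist_commute)
    ultimately obtain d where d: "d > 0" "ball y d \<subseteq> - \<Union>\<N> \<inter> ball x e"
      using openE by blast
    define t where "t = d / (2 * (norm v + 1))"
    have n: "norm v + 1 > 0" by (simp add: add_nonneg_pos)
    have t: "t > 0" using d n by (simp add: t_def)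
    have "t * norm v < t * (norm v + 1)" using t by simp
    also have "\<dots> = d / 2" using n by (simp add: t_def field_simps)
    finally have "t * norm v < d" using d by simp
    then have "y + t *\<^sub>R v \<in> ball y d" using t by (simp add: dist_norm)
    then have *: "y + t *\<^sub>R v \<in> - \<Union>\<N> \<inter> ball x e" using d by blast
    have "y + t *\<^sub>R v \<notin> N"
    proof
      assume "y + t *\<^sub>R v \<in> N"
      then have "(y + t *\<^sub>R v) - y \<in> N" using True sN subspace_diff by blast
      then have "t *\<^sub>R v \<in> N" by simp
      then have "(1/t) *\<^sub>R (t *\<^sub>R v) \<in> N" by (rule subspace_scale[OF sN])
      then show False using t v by simp
    qed
    moreover have "y + t *\<^sub>R v \<in> H" using H y v by (simp add: subspace_add subspace_scale)
    ultimately show ?thesis using * by (auto simp: dist_commute intro!: bexI[of _ "y + t *\<^sub>R v"])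
  qed
qed

section \<open>Level sets of odd functions\<close>

text \<open>
  The intermediate value theorem is applied on a segment that starts near \<open>p\<close>, where the values
  exceed \<open>c\<close>, and ends at a point \<open>w\<close> of \<open>W\<close> with a value below \<open>c\<close>.  Its starting point lies
  outside \<open>W\<close> and outside \<open>span (insert w N)\<close> for every \<open>N\<close> in the covering, none of which contains
  \<open>H\<close> for reasons of dimension.  Since \<open>w\<close> belongs to all these subspaces, the whole segment except \<open>w\<close> stays outside them, and in particular
  outside every \<open>N\<close>.
\<close>
lemma level_set_not_thin:
  fixes f :: "'a::euclidean_space \<Rightarrow> real"
  assumes cont: "continuous_on (sphere 0 1) f"
    and odd: "\<And>x. x \<in> sphere 0 1 \<Longrightarrow> f (- x) = - f x"
    and H: "subspace H" "dim H = Suc (Suc k)"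
    and W: "subspace W" "W \<subseteq> H" "dim W = Suc k"
    and p: "p \<in> sphere 0 1 \<inter> H" and c: "0 < c" "c < f p"
  shows "\<not> thin k ({x \<in> sphere 0 1 \<inter> H. f x = c} - W)"
proof
  assume "thin k ({x \<in> sphere 0 1 \<inter> H. f x = c} - W)"
  then obtain \<N> where fin: "finite \<N>" and N: "\<And>N. N \<in> \<N> \<Longrightarrow> subspace N \<and> dim N \<le> k"
    and cover: "{x \<in> sphere 0 1 \<inter> H. f x = c} - W \<subseteq> \<Union>\<N>"
    unfolding thin_def by blast
  \<comment> \<open>Segments leave the sphere, so \<open>f\<close> is extended to be constant along open rays.\<close>
  define g where "g x = f (sgn x)" for x
  have g_cont: "continuous_on (- {0}) g"
    unfolding g_def
    by (rule continuous_on_compose2[OF cont]) (auto intro!: continuous_intros simp: norm_sgn split: if_splits)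
  have g_nhds: "\<exists>e>0. \<forall>y. dist y x < e \<longrightarrow> g y \<in> U" if "x \<noteq> 0" "open U" "g x \<in> U" for x U
  proof -
    have "isCont g x" using g_cont that(1) continuous_on_eq_continuous_at[of "- {0}" g] by auto
    then have "\<forall>\<^sub>F y in nhds x. g y \<in> U"
      using that(2,3) by (simp add: continuous_at_imp_continuous_at_within isCont_def tendsto_at_iff_tendsto_nhds topological_tendstoD)
    then show ?thesis by (simp add: eventually_nhds_metric)
  qed
  have g_sphere: "g x = f x" if "x \<in> sphere 0 1" for x
    using that by (simp add: g_def sgn_div_norm)
  have "\<not> W \<subseteq> {0}" using W dim_subset[of W "{0}"] by auto
  then obtain u where u: "u \<in> W" "u \<noteq> 0" by auto
  define w where "w = (if f (sgn u) \<le> 0 then sgn u else - sgn u)"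
  have w: "w \<in> W" "w \<in> sphere 0 1" "f w \<le> 0"
    using u W odd[of "sgn u"]
    by (auto simp: w_def sgn_div_norm subspace_scale subspace_neg)
  then have w0: "w \<noteq> 0" "g w < c" using g_sphere c by auto
  have p0: "p \<noteq> 0" "g p > c" using p g_sphere c by auto
  obtain e where e: "e > 0" "\<And>y. dist y p < e \<Longrightarrow> g y > c"
    using g_nhds[of p "{c<..}"] p0 by auto
  have "\<exists>y\<in>H. dist y p < e \<and> y \<notin> \<Union>(insert W ((\<lambda>N. span (insert w N)) ` \<N>))"
  proof (rule generic_point[OF H(1)])
    fix N' assume N': "N' \<in> insert W ((\<lambda>N. span (insert w N)) ` \<N>)"
    have "dim N' \<le> Suc k"
    proof (cases "N' = W")
      case False
      then obtain N where N1: "N \<in> \<N>" "N' = span (insert w N)" using N' by auto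
      have "dim (insert w N) \<le> Suc (dim N)" by (simp add: dim_insert)
      then show ?thesis using N1 N[of N] by simp
    qed (use W in simp)
    moreover have "subspace N'" using N' W(1) by auto
    ultimately show "subspace N' \<and> \<not> H \<subseteq> N'" using H(2) dim_subset[of H N'] by auto
  qed (use fin p e in auto)
  then obtain p' where p': "p' \<in> H" "dist p' p < e" "p' \<notin> W"
    "\<And>N. N \<in> \<N> \<Longrightarrow> p' \<notin> span (insert w N)" by auto
  define \<gamma> where "\<gamma> t = (1 - t) *\<^sub>R p' + t *\<^sub>R w" for t :: real
  have only_end: "t = 1" if "\<gamma> t \<in> span (insert w N)" "p' \<notin> span (insert w N)" for t N
  proof (rule ccontr)
    assume "t \<noteq> 1"
    have "t *\<^sub>R w \<in> span (insert w N)" by (simp add: span_base span_scale)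
    then have "\<gamma> t - t *\<^sub>R w \<in> span (insert w N)" using that(1) span_diff by blast
    then have "(1 - t) *\<^sub>R p' \<in> span (insert w N)" by (simp add: \<gamma>_def)
    then have "(1 / (1 - t)) *\<^sub>R ((1 - t) *\<^sub>R p') \<in> span (insert w N)" by (rule span_scale)
    then show False using \<open>t \<noteq> 1\<close> that(2) by simp
  qed
  have spanW: "span (insert w W) = W" using W(1) w(1) by (simp add: insert_absorb span_eq_iff)
  have \<gamma>0: "\<gamma> t \<noteq> 0" for t
  proof
    assume "\<gamma> t = 0"
    moreover from this have "t = 1"
      using only_end[of t W] spanW p'(3) subspace_0[OF W(1)] by simp
    ultimately show False using w0(1) by (simp add: \<gamma>_def)
  qed
  have "continuous_on {0..1} (\<lambda>t. g (\<gamma> t))"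
    by (rule continuous_on_compose2[OF g_cont])
      (use \<gamma>0 in \<open>auto simp: \<gamma>_def intro!: continuous_intros\<close>)
  moreover have "g (\<gamma> 1) \<le> c" "c \<le> g (\<gamma> 0)"
    using w0(2) e(2)[OF p'(2)] by (auto simp: \<gamma>_def)
  ultimately obtain t where t: "g (\<gamma> t) = c"
    using IVT2'[of "\<lambda>t. g (\<gamma> t)" 1 c 0] by auto
  have t1: "t \<noteq> 1" using t w0(2) by (auto simp: \<gamma>_def)
  have "\<gamma> t \<in> H" unfolding \<gamma>_def
    using H(1) W(2) p'(1) w(1) by (auto intro!: subspace_add subspace_scale)
  then have "sgn (\<gamma> t) \<in> {x \<in> sphere 0 1 \<inter> H. f x = c}"
    using t \<gamma>0 H(1) by (auto simp: g_def norm_sgn) (simp add: sgn_div_norm subspace_scale)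
  moreover have scale_back: "\<gamma> t \<in> V" if "subspace V" "sgn (\<gamma> t) \<in> V" for V
  proof -
    have "norm (\<gamma> t) *\<^sub>R sgn (\<gamma> t) \<in> V" using that subspace_scale by blast
    then show ?thesis using \<gamma>0[of t] by (simp add: sgn_div_norm)
  qed
  moreover have "\<gamma> t \<notin> W" using only_end[of t W] t1 spanW p'(3) by auto
  ultimately obtain N1 where N1: "N1 \<in> \<N>" "\<gamma> t \<in> N1"
    using cover W(1) N by blast
  then have "\<gamma> t \<in> span (insert w N1)" by (simp add: span_base)
  then show False using only_end[of t N1] t1 p'(4) N1 by auto
qed

section \<open>Circuits in sets that are not thin\<close>

definition hyperplane_in :: "'a::euclidean_space set \<Rightarrow> 'a set \<Rightarrow> bool" where
  "hyperplane_in H W \<longleftrightarrow> subspace W \<and> W \<subseteq> H \<and> Suc (dim W) = dim H"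

text \<open>
  A good start for a circuit: independent points \<open>Q\<close> spanning a hyperplane of \<open>H\<close>, together with a
  supply \<open>X\<close> of further points that stays large after removing any hyperplane that can arise from
  \<open>Q\<close> by exchanging one point.  Call a hyperplane fat if it meets \<open>L\<close> in a set that is not thin.
  If there are two fat hyperplanes, \<open>Q\<close> is taken in one and \<open>X\<close> in the other; otherwise \<open>Q\<close> spans
  the only fat hyperplane, or an arbitrary one if none is fat, and every other hyperplane meets all
  of \<open>L\<close> in a thin set.
\<close>
lemma independent_with_fat_complement:
  fixes L :: "'a::euclidean_space set"
  assumes H: "subspace H" "dim H = Suc (Suc k)" and LH: "L \<subseteq> H"
    and fat: "\<And>W. hyperplane_in H W \<Longrightarrow> \<not> thin k (L - W)"
    and k: "1 \<le> k"
  shows "\<exists>Q X. Q \<subseteq> L \<and> independent Q \<and> card Q = Suc k \<and> X \<subseteq> L - span Q \<and> \<not> thin k X \<and>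
    (\<forall>V q. hyperplane_in H V \<longrightarrow> q \<in> Q \<longrightarrow> Q - {q} \<subseteq> V \<longrightarrow>
      V \<noteq> span Q \<longrightarrow> thin k (X \<inter> V))"
proof (cases "\<exists>W1 W2. hyperplane_in H W1 \<and> hyperplane_in H W2 \<and> W1 \<noteq> W2 \<and>
    \<not> thin k (L \<inter> W1) \<and> \<not> thin k (L \<inter> W2)")
  case True
  then obtain W1 W2 where W: "hyperplane_in H W1" "hyperplane_in H W2" "W1 \<noteq> W2"
    "\<not> thin k (L \<inter> W1)" "\<not> thin k (L \<inter> W2)" by blast
  have W12: "thin k (W1 \<inter> W2)" using W(1-3) thin_Int_hyperplanes by (auto simp: hyperplane_in_def H)
  have "\<not> thin k (L \<inter> W1 - W2)"
  proof
    assume "thin k (L \<inter> W1 - W2)"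
    from thin_Un[OF this W12] have "thin k (L \<inter> W1)" by (rule thin_subset) auto
    with W(4) show False ..
  qed
  then obtain Q where Q: "Q \<subseteq> L \<inter> W1 - W2" "independent Q" "card Q = Suc k"
    by (rule not_thin_independent)
  have spQ: "span Q = W1"
    using Q W(1) by (intro span_eq_if_card_eq_dim) (auto simp: hyperplane_in_def H)
  have "\<not> thin k (L \<inter> W2 - W1)"
  proof
    assume "thin k (L \<inter> W2 - W1)"
    from thin_Un[OF this W12] have "thin k (L \<inter> W2)" by (rule thin_subset) auto
    with W(5) show False ..
  qed
  moreover have "thin k ((L \<inter> W2 - W1) \<inter> V)"
    if V: "hyperplane_in H V" "q \<in> Q" "Q - {q} \<subseteq> V" for V q
  proof -
    \<comment> \<open>As \<open>k \<ge> 1\<close>, a point of \<open>Q\<close> survives the exchange, and it keeps \<open>V\<close> apart from \<open>W2\<close>.\<close>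
    have "finite Q" using Q(3) card.infinite by fastforce
    then have "card (Q - {q}) \<noteq> 0" using k Q(3) V(2) by simp
    then obtain q' where "q' \<in> Q - {q}" by (metis card.empty equals0I)
    then have "V \<noteq> W2" using V(3) Q(1) by auto
    then have "thin k (V \<inter> W2)" using V(1) W(2) thin_Int_hyperplanes by (auto simp: hyperplane_in_def H)
    then show ?thesis by (rule thin_subset) auto
  qed
  ultimately show ?thesis using Q spQ
    by (intro exI[of _ Q] exI[of _ "L \<inter> W2 - W1"]) auto
next
  case False
  have "\<exists>Q. Q \<subseteq> L \<and> independent Q \<and> card Q = Suc k \<and>
    (\<forall>V. hyperplane_in H V \<longrightarrow> V \<noteq> span Q \<longrightarrow> thin k (L \<inter> V))"
  proof (cases "\<exists>W. hyperplane_in H W \<and> \<not> thin k (L \<inter> W)")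
    case True
    then obtain W where W: "hyperplane_in H W" "\<not> thin k (L \<inter> W)" by blast
    obtain Q where Q: "Q \<subseteq> L \<inter> W" "independent Q" "card Q = Suc k"
      using W(2) by (rule not_thin_independent)
    have "span Q = W"
      using Q W(1) by (intro span_eq_if_card_eq_dim) (auto simp: hyperplane_in_def H)
    then show ?thesis using Q W False by (intro exI[of _ Q]) auto
  next
    case no_fat: False
    have "Suc k \<le> dim H" using H(2) by simp
    then obtain W where "subspace W" "W \<subseteq> span H" "dim W = Suc k"
      by (rule choose_subspace_of_subspace)
    moreover have "span H = H" using H(1) span_eq_iff by blast
    ultimately have W: "hyperplane_in H W" by (simp add: hyperplane_in_def H)
    have "\<not> thin k L" using W fat[of W] thin_subset[of k L "L - W"] by (auto simp: hyperplane_in_def H)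
    then obtain Q where "Q \<subseteq> L" "independent Q" "card Q = Suc k"
      by (rule not_thin_independent)
    then show ?thesis using no_fat by auto
  qed
  then obtain Q where Q: "Q \<subseteq> L" "independent Q" "card Q = Suc k"
    "\<And>V. hyperplane_in H V \<Longrightarrow> V \<noteq> span Q \<Longrightarrow> thin k (L \<inter> V)" by blast
  have "span Q \<subseteq> H" using Q(1) LH H(1) by (intro span_minimal) auto
  then have "hyperplane_in H (span Q)"
    using Q(2,3) H(2) by (simp add: hyperplane_in_def dim_eq_card_independent)
  then have "\<not> thin k (L - span Q)" by (rule fat)
  moreover have "thin k ((L - span Q) \<inter> V)" if "hyperplane_in H V" "V \<noteq> span Q" for V
    using Q(4)[OF that] by (rule thin_subset) auto
  ultimately show ?thesis using Q(1-3)
    by (intro exI[of _ Q] exI[of _ "L - span Q"]) auto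
qed

text \<open>
  To \<open>Q\<close> and \<open>X\<close> as in the preceding lemma add any \<open>a \<in> X\<close>, and then some \<open>b \<in> X\<close> outside all
  hyperplanes spanned by \<open>a\<close> and all but one point of \<open>Q\<close>; such \<open>b\<close> exists because these finitely
  many hyperplanes meet \<open>X\<close> in thin sets.  Deleting \<open>a\<close> or \<open>b\<close> leaves a basis since neither lies in
  the span of \<open>Q\<close>, and deleting a point of \<open>Q\<close> leaves a basis by the choice of \<open>b\<close>.
\<close>
lemma spanning_circuit_exists:
  fixes L :: "'a::euclidean_space set"
  assumes H: "subspace H" "dim H = Suc (Suc k)" and LH: "L \<subseteq> H"
    and fat: "\<And>W. hyperplane_in H W \<Longrightarrow> \<not> thin k (L - W)"
    and k: "1 \<le> k"
  obtains B where "B \<subseteq> L" "finite B" "card B = k + 3" "\<not> independent B"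
    "\<And>x. x \<in> B \<Longrightarrow> independent (B - {x})"
proof -
  have "\<exists>Q X. Q \<subseteq> L \<and> independent Q \<and> card Q = Suc k \<and> X \<subseteq> L - span Q \<and> \<not> thin k X \<and>
    (\<forall>V q. hyperplane_in H V \<longrightarrow> q \<in> Q \<longrightarrow> Q - {q} \<subseteq> V \<longrightarrow>
      V \<noteq> span Q \<longrightarrow> thin k (X \<inter> V))"
    by (rule independent_with_fat_complement[OF H LH _ k]) (rule fat)
  then obtain Q X where Q: "Q \<subseteq> L" "independent Q" "card Q = Suc k"
    and X: "X \<subseteq> L - span Q" "\<not> thin k X"
    and thinX: "\<forall>V q. hyperplane_in H V \<longrightarrow> q \<in> Q \<longrightarrow> Q - {q} \<subseteq> V \<longrightarrow> V \<noteq> span Q \<longrightarrow> thin k (X \<inter> V)"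
    by (elim exE conjE) (rule that)
  have finQ: "finite Q" using Q(3) card.infinite by fastforce
  have "X \<noteq> {}" using X(2) thin_subset[OF thin_subspace[of "{0}" k]] by auto
  then obtain a where a: "a \<in> X" by blast
  then have aQ: "a \<in> L" "a \<notin> span Q" using X(1) by auto
  define V where "V q = span (insert a (Q - {q}))" for q
  have indV: "independent (insert a (Q - {q}))" for q
    using aQ(2) Q(2) span_mono[of "Q - {q}" Q]
    by (metis Diff_subset independent_insertI independent_mono subset_iff)
  have "thin k (X \<inter> V q)" if q: "q \<in> Q" for q
  proof (rule thinX[rule_format, OF _ q])
    have aq: "a \<notin> Q" using aQ(2) span_base by blast
    have "card (insert a (Q - {q})) = Suc k" using finQ Q(3) q aq by simp
    then have "dim (V q) = Suc k" using indV[of q] by (simp add: V_def dim_eq_card_independent)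
    moreover have "V q \<subseteq> H"
      unfolding V_def using aQ(1) Q(1) LH H(1) by (intro span_minimal) auto
    ultimately show "hyperplane_in H (V q)" by (simp add: hyperplane_in_def H V_def)
    show "Q - {q} \<subseteq> V q" using span_superset[of "insert a (Q - {q})"] by (simp add: V_def)
    have "a \<in> V q" by (simp add: V_def span_base)
    then show "V q \<noteq> span Q" using aQ(2) by auto
  qed
  then have "thin k (\<Union>q\<in>Q. X \<inter> V q)" by (intro thin_UN finQ)
  then have "\<not> X \<subseteq> (\<Union>q\<in>Q. X \<inter> V q)" using X(2) thin_subset by blast
  then obtain b where b: "b \<in> X" "\<And>q. q \<in> Q \<Longrightarrow> b \<notin> V q" by blast
  then have bQ: "b \<in> L" "b \<notin> span Q" using X(1) by auto
  have nQ: "a \<notin> Q" "b \<notin> Q" using aQ bQ span_base by blast+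
  have ab: "a \<noteq> b"
  proof
    assume "a = b"
    moreover obtain q where "q \<in> Q" using Q(3) by fastforce
    ultimately show False using b(2)[of q] by (simp add: V_def span_base)
  qed
  define B where "B = insert b (insert a Q)"
  have cardB: "card B = k + 3" using finQ nQ ab Q(3) by (simp add: B_def)
  have BL: "B \<subseteq> L" using Q(1) aQ bQ by (auto simp: B_def)
  have "\<not> independent B"
    using independent_card_le_dim[of B H] BL LH cardB H by auto
  moreover have "independent (B - {x})" if xB: "x \<in> B" for x
  proof -
    consider "x = b" | "x = a" | "x \<in> Q" using xB by (auto simp: B_def)
    then show ?thesis
    proof cases
      case 1
      then have "B - {x} = insert a Q" using nQ ab by (auto simp: B_def)
      then show ?thesis using independent_insertI aQ(2) Q(2) by metis
    next
      case 2
      then have "B - {x} = insert b Q" using nQ ab by (auto simp: B_def)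
      then show ?thesis using independent_insertI bQ(2) Q(2) by metis
    next
      case 3
      then have "B - {x} = insert b (insert a (Q - {x}))" using nQ by (auto simp: B_def)
      then show ?thesis using independent_insertI b(2)[OF 3] indV[of x] by (metis V_def)
    qed
  qed
  moreover have "finite B" using finQ by (simp add: B_def)
  ultimately show ?thesis using that BL cardB by blast
qed

section \<open>Circuits on a level set\<close>

lemma level_circuit_exists:
  fixes f :: "'a::euclidean_space \<Rightarrow> real"
  assumes "continuous_on (sphere 0 1) f"
    and "\<And>x. x \<in> sphere 0 1 \<Longrightarrow> f (- x) = - f x"
    and dim: "DIM('a) = k + 3" "1 \<le> k"
    and p: "p \<in> sphere 0 1" "f p \<noteq> 0"
  obtains B c where "B \<subseteq> {x \<in> sphere 0 1. f x = c}" "finite B" "card B = k + 3"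
    "\<not> independent B" "\<And>x. x \<in> B \<Longrightarrow> independent (B - {x})"
proof -
  obtain p' where p': "p' \<in> sphere 0 1" "f p' > 0"
  proof (cases "f p > 0")
    case False
    then have "f (- p) > 0" using assms(2)[OF p(1)] p(2) by simp
    then show ?thesis using that[of "- p"] p(1) by simp
  qed (use that p in blast)
  \<comment> \<open>Drop a vector other than \<open>p'\<close> from a basis of the whole space containing \<open>p'\<close>.\<close>
  obtain H where H: "subspace H" "p' \<in> H" "dim H = Suc (Suc k)"
  proof -
    have ip: "independent {p'}" using p' by auto
    have "{p'} \<subseteq> UNIV" by simp
    then obtain B :: "'a set" where B: "{p'} \<subseteq> B" "independent B" "UNIV \<subseteq> span B"
      using maximal_independent_subset_extend[OF _ ip] by metis
    then have "span B = UNIV" by auto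
    then have "dim (span B) = k + 3" using dim(1) by simp
    then have cB: "card B = k + 3" using B(2) by (simp add: dim_eq_card_independent)
    then have "B \<noteq> {p'}" by auto
    then obtain b where b: "b \<in> B" "b \<noteq> p'" using B(1) by blast
    have "card (B - {b}) = Suc (Suc k)" using b cB by simp
    then show ?thesis
      using that[of "span (B - {b})"] b B independent_mono[of B "B - {b}"]
      by (auto simp: dim_eq_card_independent span_base)
  qed
  define c where "c = f p' / 2"
  have c: "0 < c" "c < f p'" using p' by (auto simp: c_def)
  show ?thesis
  proof (rule spanning_circuit_exists[of H k "{x \<in> sphere 0 1 \<inter> H. f x = c}"])
    fix B assume "B \<subseteq> {x \<in> sphere 0 1 \<inter> H. f x = c}" "finite B" "card B = k + 3" "\<not> independent B"
      "\<And>x. x \<in> B \<Longrightarrow> independent (B - {x})"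
    then show thesis by (intro that[of B c]) auto
  next
    fix W assume "hyperplane_in H W"
    then show "\<not> thin k ({x \<in> sphere 0 1 \<inter> H. f x = c} - W)"
      using level_set_not_thin[OF assms(1,2) H(1) H(3) _ _ _ _ c] p' H by (auto simp: hyperplane_in_def)
  qed (use dim H in auto)
qed

theorem corollary4p9:
  fixes m :: nat and f :: "real ^ 'n \<Rightarrow> real"
  assumes "m \<ge> 1"
    and "CARD('n) = m + 1"
    and "continuous_on (sphere 0 1) f"
    and "\<forall>p\<in>sphere 0 1. f (- p) = - f p"
    and "\<exists>k::nat. m + 1 = 2 ^ k"
  shows "\<exists>p :: nat \<Rightarrow> real ^ 'n.
      (\<forall>i\<in>{1..m+1}. p i \<in> sphere 0 1) \<and>
      (\<forall>i\<in>{1..m+1}. \<forall>j\<in>{1..m+1}. f (p i) = f (p j)) \<and>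
      \<not> indep_family {1..m+1} p \<and>
      (\<forall>I. I \<subseteq> {1..m+1} \<and> card I = m \<longrightarrow> indep_family I p)"
proof (cases "m = 1")
  case True
  define e :: "real ^ 'n" where "e = axis undefined 1"
  have e: "e \<in> sphere 0 1" "e \<noteq> 0" by (simp_all add: e_def)
  have "\<not> indep_family {1..m+1} (\<lambda>_. e)"
    using True inj_onD[of "\<lambda>_. e" "{1..m+1}" 1 2] by (fastforce simp: indep_family_def)
  moreover have "indep_family I (\<lambda>_. e)" if "card I = m" for I :: "nat set"
    using that True e(2) by (auto simp: card_1_singleton_iff indep_family_def)
  ultimately show ?thesis using e by (intro exI[of _ "\<lambda>_. e"]) auto
next
  case False
  have "m \<noteq> 2"
  proof
    assume "m = 2"
    with assms(5) obtain k :: nat where "3 = (2::nat) ^ k" by auto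
    then show False
    proof (cases k)
      case (Suc j)
      then have "3 = 2 * (2::nat) ^ j" using \<open>3 = 2 ^ k\<close> by simp
      then show False by presburger
    qed (use \<open>3 = 2 ^ k\<close> in simp)
  qed
  then obtain k where k: "m = k + 2" "1 \<le> k"
    using False assms(1) that[of "m - 2"] by force
  have dim: "DIM(real ^ 'n) = k + 3" using assms(2) k by simp
  have "\<exists>B c. B \<subseteq> {x \<in> sphere 0 1. f x = c} \<and> finite B \<and> card B = k + 3 \<and>
    \<not> independent B \<and> (\<forall>x\<in>B. independent (B - {x}))"
  proof (cases "\<exists>p\<in>sphere 0 1. f p \<noteq> 0")
    case True
    then obtain p where "p \<in> sphere 0 1" "f p \<noteq> 0" by blast
    then obtain B c where "B \<subseteq> {x \<in> sphere 0 1. f x = c}" "finite B" "card B = k + 3"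
      "\<not> independent B" "\<And>x. x \<in> B \<Longrightarrow> independent (B - {x})"
      using level_circuit_exists[OF assms(3) assms(4)[rule_format] dim k(2)] by blast
    then show ?thesis by blast
  next
    case False
    \<comment> \<open>If \<open>f\<close> vanishes on the sphere, any circuit of unit vectors serves; a linear form in place of
      \<open>f\<close> produces one.\<close>
    define e :: "real ^ 'n" where "e = axis undefined 1"
    obtain B c where "B \<subseteq> {x \<in> sphere 0 1. e \<bullet> x = c}" "finite B" "card B = k + 3"
      "\<not> independent B" "\<And>x. x \<in> B \<Longrightarrow> independent (B - {x})"
    proof (rule level_circuit_exists[of "\<lambda>x. e \<bullet> x" k e])
      show "continuous_on (sphere 0 1) ((\<bullet>) e)" by (intro continuous_intros)
    qed (use dim k in \<open>auto simp: e_def inner_axis_axis\<close>)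
    then show ?thesis using False by (intro exI[of _ B] exI[of _ 0]) auto
  qed
  then obtain B c where B: "B \<subseteq> {x \<in> sphere 0 1. f x = c}" "finite B" "card B = m + 1"
    "\<not> independent B" "\<And>x. x \<in> B \<Longrightarrow> independent (B - {x})" using k(1) by auto
  obtain p where p: "bij_betw p {1..m+1} B"
    using ex_bij_betw_nat_finite_1[OF B(2)] B(3) by auto
  have pB: "p i \<in> B" if "i \<in> {1..m+1}" for i using p that bij_betwE by blast
  have "indep_family I p" if I: "I \<subseteq> {1..m+1}" "card I = m" for I
  proof -
    obtain j where j: "j \<in> {1..m+1}" "j \<notin> I"
    proof -
      have "card I \<noteq> card {1..m+1}" using I(2) by simp
      then have "I \<noteq> {1..m+1}" by blast
      then show ?thesis using that I(1) by blast
    qed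
    have "p ` I \<subseteq> B - {p j}"
      using p I(1) j by (auto simp: bij_betw_def dest: inj_onD)
    then have "independent (p ` I)" using B(5)[OF pB[OF j(1)]] independent_mono by blast
    moreover have "inj_on p I" using p I(1) inj_on_subset by (auto simp: bij_betw_def)
    ultimately show ?thesis by (simp add: indep_family_def)
  qed
  moreover have "\<not> indep_family {1..m+1} p"
    using B(4) p by (simp add: indep_family_def bij_betw_def)
  moreover have "p i \<in> sphere 0 1 \<and> f (p i) = c" if "i \<in> {1..m+1}" for i
    using pB[OF that] B(1) by auto
  ultimately show ?thesis by (intro exI[of _ p]) auto
qed

end
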